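(* Let $d\ge 1$ and $t\ge 1$ be integers and let $H$ be a nonempty connected simple graph with the path metric. Then the following are equivalent: (i) for every $A\subset\mathbb{Z}^d$, every $t$-Lipschitz map $f:A\to H$ has a $t$-Lipschitz extension $\mathbb{Z}^d\to H$; (ii) for all (not necessarily distinct) balls $B_1,B_2,\dots,B_{2d}$ in $H$ whose radii are integer multiples of $t$, if the balls pairwise intersect, i.e. $B_i\cap B_j\ne\varnothing$ for all $1\le i,j\le 2d$, then $\bigcap_{i=1}^{2d}B_i\neq\varnothing$.
   Context: A graph is identified with its vertex set, viewed as a metric space with the path metric; graphs may be infinite. $\mathbb{Z}^d$ denotes the Cayley graph of the group $\mathbb{Z}^d$ with respect to the standard generators (path metric $=\ell_1$ metric), and subsets $A\subset\mathbb{Z}^d$ carry the restricted metric. A map $f$ is $t$-Lipschitz if $d_H(f(a),f(a'))\le t\, d(a,a')$ for all $a,a'$. Balls are closed balls $\{w: d_H(v,w)\le r\}$ with $r\ge 0$. *)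

theory Defs
  imports "HOL-Analysis.Finite_Cartesian_Product" "Graph_Theory.Graph_Theory"
begin

text \<open>
  A (possibly infinite) simple graph is a \<open>pair_bidirected_digraph\<close>: its arcs form a symmetric
  irreflexive relation on its vertex set.
\<close>

text \<open>
  The length of a shortest walk from \<open>u\<close> to \<open>v\<close>. The junk value 0 for vertices not joined by a walk
  never arises in a connected graph.
\<close>

definition path_dist :: "'a pair_pre_digraph \<Rightarrow> 'a \<Rightarrow> 'a \<Rightarrow> nat" where
  "path_dist G u v = (INF p \<in> {p. pre_digraph.awalk (with_proj G) u p v}. length p)"

definition path_ball :: "'a pair_pre_digraph \<Rightarrow> 'a \<Rightarrow> nat \<Rightarrow> 'a set" where
  "path_ball G v r = {w \<in> pverts G. path_dist G v w \<le> r}"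

text \<open>
  Here \<open>A\<close> is a set of vertices of \<open>G\<close> carrying the metric restricted from \<open>G\<close> (not the path metric
  of the subgraph induced by \<open>A\<close>).
\<close>

definition lipschitz_map ::
    "nat \<Rightarrow> 'b pair_pre_digraph \<Rightarrow> 'b set \<Rightarrow> 'a pair_pre_digraph \<Rightarrow> ('b \<Rightarrow> 'a) \<Rightarrow> bool" where
  "lipschitz_map t G A H f \<longleftrightarrow>
     f ` A \<subseteq> pverts H \<and>
     (\<forall>a\<in>A. \<forall>a'\<in>A. path_dist H (f a) (f a') \<le> t * path_dist G a a')"

text \<open>
  The dimension \<open>d\<close> is \<open>CARD('d)\<close>; the standard generators are the vectors \<open>axis i 1\<close>.
\<close>

definition int_lattice :: "(int ^ 'd) pair_pre_digraph" where
  "int_lattice =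
     \<lparr> pverts = UNIV,
       parcs = {(x, y). \<exists>i. y = x + axis i 1 \<or> x = y + axis i 1} \<rparr>"

end

theory Submission
  imports Defs
begin

text \<open>
  The Helly property gives an extension to one more point \<open>x\<close> as soon as the map is defined at no
  more than \<open>2d\<close> points. For a larger finite domain, some point \<open>a\<close> of it is not strictly extremal in
  any of the \<open>2d\<close> signed directions. Walk from \<open>a\<close> to \<open>x\<close>: if \<open>a\<close> lies beyond \<open>x\<close> in direction \<open>e\<close>, then
  at least two points do, and once a value at \<open>x + e\<close> is known it subsumes the constraints that all of
  them impose at \<open>x\<close>. Replacing them by \<open>x + e\<close> makes the domain smaller. For infinite domains,
  Dickson's lemma leaves only finitely many relevant constraints at \<open>x\<close>: a point \<open>b\<close> may be dropped
  when another one lies on a geodesic from \<open>b\<close> to \<open>x\<close>. Zorn's lemma then yields a total extension.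
\<close>

section \<open>Path metric\<close>

lemma path_dist_le_length:
  assumes "pre_digraph.awalk (with_proj G) u p v"
  shows "path_dist G u v \<le> length p"
  unfolding path_dist_def using assms by (intro cInf_lower) auto

lemma shortest_awalkE:
  assumes "pre_digraph.awalk (with_proj G) u p v"
  obtains q where "pre_digraph.awalk (with_proj G) u q v" "length q = path_dist G u v"
proof -
  have "path_dist G u v \<in> length ` {p. pre_digraph.awalk (with_proj G) u p v}"
    unfolding path_dist_def using assms by (intro Inf_nat_def1) auto
  then show thesis using that by auto
qed

lemma length_rev_path: "length (rev_path p) = length p"
  by (induction p) auto

text \<open>Directed reachability makes the infimum in \<open>path_dist\<close> attained between any
  two vertices, so the junk value never occurs; symmetry of the arcs makes the distance a
  metric.\<close>

locale connected_sym_digraph = pair_sym_digraph G for G :: "'a pair_pre_digraph" +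
  assumes reachable_verts: "u \<in> pverts G \<Longrightarrow> v \<in> pverts G \<Longrightarrow> u \<rightarrow>\<^sup>*\<^bsub>with_proj G\<^esub> v"
begin

lemma shortest_awalk:
  assumes "u \<in> pverts G" "v \<in> pverts G"
  obtains p where "awalk u p v" "length p = path_dist G u v"
  using reachable_verts[OF assms] shortest_awalkE unfolding reachable_awalk by metis

lemma path_dist_self [simp]: "u \<in> pverts G \<Longrightarrow> path_dist G u u = 0"
  using path_dist_le_length[of G u "[]" u] by (simp add: awalk_Nil_iff)

lemma path_dist_eq_0D:
  assumes "u \<in> pverts G" "v \<in> pverts G" "path_dist G u v = 0"
  shows "u = v"
  using shortest_awalk[OF assms(1,2)] assms(3) by (metis awalk_Nil_iff length_0_conv)

lemma path_dist_le_sym: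
  assumes "u \<in> pverts G" "v \<in> pverts G"
  shows "path_dist G v u \<le> path_dist G u v"
proof -
  obtain p where "awalk u p v" and p: "length p = path_dist G u v"
    using shortest_awalk[OF assms] .
  then have "awalk v (rev_path p) u" by simp
  from path_dist_le_length[OF this] p show ?thesis by (simp add: length_rev_path)
qed

lemma path_dist_sym:
  "u \<in> pverts G \<Longrightarrow> v \<in> pverts G \<Longrightarrow> path_dist G u v = path_dist G v u"
  by (intro antisym path_dist_le_sym)

lemma path_dist_triangle:
  assumes "u \<in> pverts G" "v \<in> pverts G" "w \<in> pverts G"
  shows "path_dist G u w \<le> path_dist G u v + path_dist G v w"
proof -
  obtain p where p: "awalk u p v" "length p = path_dist G u v"
    using shortest_awalk[OF assms(1,2)] .
  obtain q where q: "awalk v q w" "length q = path_dist G v w"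
    using shortest_awalk[OF assms(2,3)] .
  show ?thesis using path_dist_le_length[OF awalk_appendI[OF p(1) q(1)]] p(2) q(2) by simp
qed

text \<open>Cut a shortest walk from \<open>u\<close> to \<open>v\<close> after \<open>r\<close>
  steps: the cut vertex \<open>w\<close> lies in both balls. If the walk has fewer than
  \<open>r\<close> arcs, then \<open>w = v\<close>.\<close>

lemma path_balls_meet:
  assumes "u \<in> pverts G" "v \<in> pverts G" "path_dist G u v \<le> r + s"
  shows "path_ball G u r \<inter> path_ball G v s \<noteq> {}"
proof -
  obtain p where p: "awalk u p v" "length p = path_dist G u v"
    using shortest_awalk[OF assms(1,2)] .
  then have "awalk u (take r p @ drop r p) v" by simp
  then obtain w where w: "awalk u (take r p) w" "awalk w (drop r p) v"
    by (auto simp: awalk_append_iff simp del: append_take_drop_id)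
  then have V: "w \<in> pverts G" by auto
  have "path_dist G u w \<le> r" using path_dist_le_length[OF w(1)] by simp
  moreover have "path_dist G v w \<le> s"
    using path_dist_le_length[OF w(2)] p(2) assms(3) path_dist_sym[OF assms(2) V] by simp
  ultimately show ?thesis using V by (auto simp: path_ball_def)
qed

end

section \<open>The lattice\<close>

definition l1 :: "int ^ 'd \<Rightarrow> int ^ 'd \<Rightarrow> nat" where
  "l1 x y = (\<Sum>i\<in>UNIV. nat \<bar>x $ i - y $ i\<bar>)"

text \<open>A pair \<open>(i, s)\<close> is a signed coordinate direction: \<open>s\<close> tells whether it is that of \<open>+e\<^sub>i\<close>.\<close>

definition coord :: "'d \<times> bool \<Rightarrow> int ^ 'd \<Rightarrow> int" where
  "coord e x = (if snd e then x $ fst e else - x $ fst e)"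

definition dir :: "'d \<times> bool \<Rightarrow> int \<Rightarrow> int ^ 'd" where
  "dir e k = axis (fst e) (if snd e then k else - k)"

lemma l1_sym: "l1 x y = l1 y x"
  by (simp add: l1_def abs_minus_commute)

lemma l1_self [simp]: "l1 x x = 0"
  by (simp add: l1_def)

lemma l1_eq_0_iff: "l1 x y = 0 \<longleftrightarrow> x = y"
  by (auto simp: l1_def vec_eq_iff)

lemma l1_triangle: "l1 x z \<le> l1 x y + l1 y z"
  unfolding l1_def sum.distrib[symmetric] by (intro sum_mono) auto

lemma coord_less_if_neq:
  assumes "x \<noteq> y"
  obtains e where "coord e x < coord e y"
proof -
  obtain i where "x $ i \<noteq> y $ i" using assms by (auto simp: vec_eq_iff)
  then have "coord (i, True) x < coord (i, True) y \<or> coord (i, False) x < coord (i, False) y"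
    by (auto simp: coord_def)
  then show thesis using that by blast
qed

lemma l1_remove:
  "l1 x y = nat \<bar>x $ i - y $ i\<bar> + (\<Sum>j\<in>UNIV - {i}. nat \<bar>x $ j - y $ j\<bar>)"
  unfolding l1_def by (intro sum.remove) auto

lemma l1_step_towards:
  assumes "coord e x < coord e y"
  shows "l1 x y = Suc (l1 (x + dir e 1) y)"
proof -
  have "(\<Sum>j\<in>UNIV - {fst e}. nat \<bar>(x + dir e 1) $ j - y $ j\<bar>)
      = (\<Sum>j\<in>UNIV - {fst e}. nat \<bar>x $ j - y $ j\<bar>)"
    by (intro sum.cong) (auto simp: dir_def axis_def)
  then show ?thesis
    using assms unfolding l1_remove[of _ _ "fst e"]
    by (auto simp: coord_def dir_def axis_def split: if_splits)
qed

lemma l1_step_away: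
  assumes "coord e y \<le> coord e x"
  shows "l1 (x + dir e 1) y = Suc (l1 x y)"
proof -
  have "(\<Sum>j\<in>UNIV - {fst e}. nat \<bar>(x + dir e 1) $ j - y $ j\<bar>)
      = (\<Sum>j\<in>UNIV - {fst e}. nat \<bar>x $ j - y $ j\<bar>)"
    by (intro sum.cong) (auto simp: dir_def axis_def)
  then show ?thesis
    using assms unfolding l1_remove[of _ _ "fst e"]
    by (auto simp: coord_def dir_def axis_def split: if_splits)
qed

lemma l1_add_axis: "l1 u (u + axis i 1) = 1"
  using l1_step_towards[of "(i, True)" u "u + axis i 1"] by (simp add: coord_def dir_def)

text \<open>The premise compares positive parts of displacements from \<open>x\<close>. Taken for
  both signs of coordinate \<open>i\<close>, it puts \<open>a $ i\<close> between
  \<open>x $ i\<close> and \<open>b $ i\<close>, so the distances add up coordinatewise.\<close>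

lemma l1_between:
  assumes "\<And>e. nat (coord e a - coord e x) \<le> nat (coord e b - coord e x)"
  shows "l1 b x = l1 b a + l1 a x"
  unfolding l1_def sum.distrib[symmetric]
proof (intro sum.cong refl)
  fix i
  show "nat \<bar>b $ i - x $ i\<bar> = nat \<bar>b $ i - a $ i\<bar> + nat \<bar>a $ i - x $ i\<bar>"
    using assms[of "(i, True)"] assms[of "(i, False)"]
    by (cases "x $ i" "a $ i" rule: linorder_cases)
      (auto simp: coord_def nat_add_distrib[symmetric] nat_le_eq_zle)
qed

lemma l1_zero_dir: "l1 0 (dir e k) = nat \<bar>k\<bar>"
  by (simp add: l1_remove[of _ _ "fst e"]) (simp add: dir_def axis_def)

text \<open>The origin lies on a geodesic between points of distinct signed half-axes, also when
  these are the two halves of one coordinate line.\<close>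

lemma l1_dir_dir:
  assumes "e \<noteq> e'" "k \<ge> 0" "k' \<ge> 0"
  shows "l1 (dir e k) (dir e' k') = nat k + nat k'"
proof -
  have "l1 (dir e' k') (dir e k) = l1 (dir e' k') 0 + l1 0 (dir e k)"
    by (rule l1_between) (use assms in \<open>auto simp: coord_def dir_def axis_def prod_eq_iff split: if_splits\<close>)
  then show ?thesis
    using assms by (simp add: l1_sym[of "dir e' k'"] l1_zero_dir)
qed

text \<open>Each arc has \<open>l1\<close>-length 1, so no walk is shorter than
  \<open>l1 x y\<close>; repeatedly stepping in a direction in which \<open>x\<close> falls short of
  \<open>y\<close> attains this length.\<close>

lemma path_dist_int_lattice: "path_dist int_lattice x y = l1 x y"
proof (rule antisym)
  have *: "l1 x y \<le> length p" if "pcas x p y" "set p \<subseteq> parcs int_lattice" for p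
    using that
  proof (induction x p y rule: pcas.induct)
    case (2 u e es v)
    then have "l1 (snd e) v \<le> length es" by auto
    moreover have "l1 u (snd e) \<le> 1"
      using 2 by (auto simp: int_lattice_def l1_add_axis l1_sym[of "_ + _"])
    ultimately show ?case using l1_triangle[of u v "snd e"] by simp
  qed simp
  have "\<exists>p. pre_digraph.awalk (with_proj int_lattice) x p y \<and> length p = l1 x y"
  proof (induction "l1 x y" arbitrary: x)
    case 0
    then show ?case by (auto simp: l1_eq_0_iff pre_digraph.awalk_def int_lattice_def pre_digraph.cas.simps intro: exI[of _ "[]"])
  next
    case (Suc n)
    then have "x \<noteq> y" by auto
    then obtain e where e: "coord e x < coord e y" by (rule coord_less_if_neq)
    then obtain p where p: "pre_digraph.awalk (with_proj int_lattice) (x + dir e 1) p y"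
      "length p = n"
      using Suc l1_step_towards[OF e] by force
    have "(x, x + dir e 1) \<in> parcs int_lattice"
      by (cases e) (auto simp: int_lattice_def dir_def axis_def vec_eq_iff)
    then have "pre_digraph.awalk (with_proj int_lattice) x ((x, x + dir e 1) # p) y"
      using p(1) by (auto simp: pre_digraph.awalk_def int_lattice_def pre_digraph.cas.simps)
    then show ?case using p(2) Suc(2) by (intro exI[of _ "(x, x + dir e 1) # p"]) auto
  qed
  then obtain p where p: "pre_digraph.awalk (with_proj int_lattice) x p y" "length p = l1 x y"
    by auto
  show "path_dist int_lattice x y \<le> l1 x y" using path_dist_le_length[OF p(1)] p(2) by simp
  obtain q where q: "pre_digraph.awalk (with_proj int_lattice) x q y"
    "length q = path_dist int_lattice x y"
    using shortest_awalkE[OF p(1)] .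
  show "l1 x y \<le> path_dist int_lattice x y"
    using *[of q] q by (simp add: pre_digraph.awalk_def cas_with_proj_eq)
qed

section \<open>Finite reduction\<close>

text \<open>Induction on \<open>J\<close>. Let \<open>F0\<close> serve for the coordinates in
  \<open>J\<close> and let \<open>N\<close> bound \<open>g j\<close> on \<open>F0\<close>. Then
  \<open>F0\<close> also serves every \<open>a\<close> with \<open>g j a \<ge> N\<close>; the others
  lie in finitely many slices on which \<open>g j\<close> is constant, and the induction hypothesis
  applies to each slice.\<close>

lemma dickson:
  fixes g :: "'j \<Rightarrow> 'b \<Rightarrow> nat"
  assumes "finite J"
  shows "\<exists>F\<subseteq>A. finite F \<and> (\<forall>a\<in>A. \<exists>c\<in>F. \<forall>j\<in>J. g j c \<le> g j a)"
  using assms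
proof (induction J arbitrary: A rule: finite_induct)
  case empty
  show ?case
  proof (cases "A = {}")
    case False
    then obtain a where "a \<in> A" by blast
    then show ?thesis by (intro exI[of _ "{a}"]) auto
  qed simp
next
  case (insert j J)
  obtain F0 where F0: "F0 \<subseteq> A" "finite F0" "\<forall>a\<in>A. \<exists>c\<in>F0. \<forall>j\<in>J. g j c \<le> g j a"
    using insert.IH[of A] by auto
  obtain N where N: "\<And>c. c \<in> F0 \<Longrightarrow> g j c \<le> N"
    using finite_nat_set_iff_bounded_le[of "g j ` F0"] F0(2) by auto
  define A' where "A' = (\<lambda>v. {a \<in> A. g j a = v})"
  have "\<forall>v. \<exists>F. F \<subseteq> A' v \<and> finite F \<and> (\<forall>a\<in>A' v. \<exists>c\<in>F. \<forall>j\<in>J. g j c \<le> g j a)"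
    using insert.IH by simp
  then obtain F where F: "\<And>v. F v \<subseteq> A' v" "\<And>v. finite (F v)"
    "\<And>v a. a \<in> A' v \<Longrightarrow> \<exists>c\<in>F v. \<forall>j\<in>J. g j c \<le> g j a"
    by metis
  show ?case
  proof (intro exI[of _ "F0 \<union> (\<Union>v<N. F v)"] conjI ballI)
    show "F0 \<union> (\<Union>v<N. F v) \<subseteq> A" using F0(1) F(1) by (auto simp: A'_def)
    show "finite (F0 \<union> (\<Union>v<N. F v))" using F0(2) F(2) by simp
    fix a assume a: "a \<in> A"
    show "\<exists>c\<in>F0 \<union> (\<Union>v<N. F v). \<forall>j\<in>insert j J. g j c \<le> g j a"
    proof (cases "g j a < N")
      case True
      obtain c where "c \<in> F (g j a)" "\<forall>j\<in>J. g j c \<le> g j a"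
        using F(3)[of a "g j a"] a by (auto simp: A'_def)
      then show ?thesis using True F(1)[of "g j a"] by (intro bexI[of _ c]) (auto simp: A'_def)
    next
      case False
      obtain c where "c \<in> F0" "\<forall>j\<in>J. g j c \<le> g j a" using F0(3) a by blast
      then show ?thesis using False N[of c] by (intro bexI[of _ c]) auto
    qed
  qed
qed

section \<open>Extending Lipschitz maps\<close>

text \<open>Condition (ii) for \<open>n\<close> balls, worded so that the theorem can be folded into
  it.\<close>

definition helly_multiples :: "nat \<Rightarrow> nat \<Rightarrow> 'a pair_pre_digraph \<Rightarrow> bool" where
  "helly_multiples n t G \<longleftrightarrow>
     (\<forall>B :: nat \<Rightarrow> 'a set.
        (\<forall>i\<in>{1..n}. \<exists>v\<in>pverts G. \<exists>k. B i = path_ball G v (k * t)) \<longrightarrow>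
        (\<forall>i\<in>{1..n}. \<forall>j\<in>{1..n}. B i \<inter> B j \<noteq> {}) \<longrightarrow>
        (\<Inter>i\<in>{1..n}. B i) \<noteq> {})"

text \<open>
  A partial \<open>t\<close>-Lipschitz map is represented by its graph; the Lipschitz inequality at distance 0
  makes such a relation single-valued.
\<close>

definition lipschitz_rel :: "nat \<Rightarrow> 'a pair_pre_digraph \<Rightarrow> ((int ^ 'd) \<times> 'a) set \<Rightarrow> bool" where
  "lipschitz_rel t G R \<longleftrightarrow> snd ` R \<subseteq> pverts G \<and>
     (\<forall>p\<in>R. \<forall>q\<in>R. path_dist G (snd p) (snd q) \<le> t * l1 (fst p) (fst q))"

definition admissible ::
    "nat \<Rightarrow> 'a pair_pre_digraph \<Rightarrow> ((int ^ 'd) \<times> 'a) set \<Rightarrow> int ^ 'd \<Rightarrow> 'a \<Rightarrow> bool" where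
  "admissible t G R x y \<longleftrightarrow> y \<in> pverts G \<and>
     (\<forall>p\<in>R. path_dist G y (snd p) \<le> t * l1 x (fst p))"

lemma lipschitz_rel_subset: "lipschitz_rel t G R \<Longrightarrow> S \<subseteq> R \<Longrightarrow> lipschitz_rel t G S"
  unfolding lipschitz_rel_def by blast

text \<open>Pigeonhole: otherwise each point is strictly extremal in some signed direction, and two
  points cannot share such a direction, of which there are only \<open>2 * CARD('d)\<close>.\<close>

lemma exists_nonextremal_point:
  fixes R :: "((int ^ 'd) \<times> 'a) set"
  assumes "finite R" "card R > 2 * CARD('d)"
  obtains p where "p \<in> R" "\<And>e. \<exists>q\<in>R. q \<noteq> p \<and> coord e (fst p) \<le> coord e (fst q)"
proof -
  have "\<exists>p\<in>R. \<forall>e. \<exists>q\<in>R. q \<noteq> p \<and> coord e (fst p) \<le> coord e (fst q)"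
  proof (rule ccontr)
    assume "\<not> ?thesis"
    then have "\<forall>p\<in>R. \<exists>e. \<forall>q\<in>R. q \<noteq> p \<longrightarrow> coord e (fst q) < coord e (fst p)"
      by (meson not_le)
    then obtain h where
      h: "\<And>p q. p \<in> R \<Longrightarrow> q \<in> R \<Longrightarrow> q \<noteq> p \<Longrightarrow> coord (h p) (fst q) < coord (h p) (fst p)"
      by metis
    have "inj_on h R"
      by (rule inj_onI, rule ccontr) (metis h less_asym)
    then have "card R \<le> CARD('d \<times> bool)"
      by (rule card_inj_on_le) auto
    with assms show False by simp
  qed
  then show thesis using that by blast
qed

section \<open>Admissible values at one further point\<close>

context connected_sym_digraph
begin

lemma lipschitz_rel_insert:
  assumes "lipschitz_rel t G R" "admissible t G R x y"
  shows "lipschitz_rel t G (insert (x, y) R)"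
proof -
  have "path_dist G (snd p) y \<le> t * l1 (fst p) x" if "p \<in> R" for p
  proof -
    have "path_dist G (snd p) y = path_dist G y (snd p)"
      using assms that by (intro path_dist_sym) (auto simp: lipschitz_rel_def admissible_def)
    then show ?thesis using assms(2) that by (simp add: admissible_def l1_sym[of x])
  qed
  then show ?thesis using assms by (auto simp: lipschitz_rel_def admissible_def)
qed

lemma lipschitz_rel_single_valued:
  assumes "lipschitz_rel t G R" "(x, y) \<in> R" "(x, z) \<in> R"
  shows "y = z"
  using assms by (intro path_dist_eq_0D) (force simp: lipschitz_rel_def)+

text \<open>If \<open>c\<close> lies on a geodesic from \<open>x\<close> to \<open>a\<close>, the
  triangle inequality through the value at \<open>c\<close> yields the constraint of
  \<open>a\<close>, which may thus be dropped.\<close>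

lemma admissible_transfer:
  assumes "admissible t G R x y" "lipschitz_rel t G (insert a R)" "c \<in> R"
    and "l1 x (fst a) = l1 x (fst c) + l1 (fst c) (fst a)"
  shows "path_dist G y (snd a) \<le> t * l1 x (fst a)"
proof -
  have "path_dist G y (snd a) \<le> path_dist G y (snd c) + path_dist G (snd c) (snd a)"
    using assms(1-3) by (intro path_dist_triangle) (auto simp: lipschitz_rel_def admissible_def)
  also have "\<dots> \<le> t * l1 x (fst c) + t * l1 (fst c) (fst a)"
    using assms(1-3) by (intro add_mono) (auto simp: lipschitz_rel_def admissible_def)
  finally show ?thesis by (simp add: assms(4) distrib_left)
qed

text \<open>Each point of \<open>R\<close> confines the value at \<open>x\<close> to a ball. The
  Lipschitz condition bounds the distance of two centres by the sum of the radii, so the balls meet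
  pairwise; a common point is admissible.\<close>

lemma admissible_if_card_le:
  fixes R :: "((int ^ 'd) \<times> 'a) set"
  assumes helly: "helly_multiples n t G" and R: "lipschitz_rel t G R"
    and "finite R" "card R \<le> n" "pverts G \<noteq> {}"
  shows "\<exists>y. admissible t G R x y"
proof (cases "R = {}")
  case True
  then show ?thesis using assms(5) by (auto simp: admissible_def)
next
  case False
  obtain h where h: "bij_betw h {0..<card R} R"
    using ex_bij_betw_nat_finite[OF \<open>finite R\<close>] by blast
  have pos: "card R > 0" using False \<open>finite R\<close> by (simp add: card_gt_0_iff)
  \<comment> \<open>Balls are counted from 1 but \<open>h\<close> from 0, hence the shift. Indices
    beyond \<open>card R\<close> repeat \<open>h 0\<close>, padding the family to \<open>n\<close>
    balls.\<close>
  define e where "e i = h (if i - 1 < card R then i - 1 else 0)" for i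
  define B where "B i = path_ball G (snd (e i)) (l1 x (fst (e i)) * t)" for i
  have eR: "e i \<in> R" for i
    using bij_betwE[OF h] pos by (simp add: e_def)
  have eV: "snd (e i) \<in> pverts G" for i
    using R eR unfolding lipschitz_rel_def by blast
  have "B i \<inter> B j \<noteq> {}" for i j
    unfolding B_def
  proof (rule path_balls_meet[OF eV eV])
    have "path_dist G (snd (e i)) (snd (e j)) \<le> t * l1 (fst (e i)) (fst (e j))"
      using R eR by (auto simp: lipschitz_rel_def)
    also have "\<dots> \<le> t * (l1 (fst (e i)) x + l1 x (fst (e j)))"
      by (intro mult_left_mono l1_triangle) simp
    finally show "path_dist G (snd (e i)) (snd (e j)) \<le> l1 x (fst (e i)) * t + l1 x (fst (e j)) * t"
      by (simp add: algebra_simps l1_sym[of x])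
  qed
  moreover have "\<forall>i\<in>{1..n}. \<exists>v\<in>pverts G. \<exists>k. B i = path_ball G v (k * t)"
    unfolding B_def using eV by blast
  ultimately have "(\<Inter>i\<in>{1..n}. B i) \<noteq> {}"
    using helly unfolding helly_multiples_def by blast
  then obtain y where y: "\<And>i. i \<in> {1..n} \<Longrightarrow> y \<in> B i" by blast
  have yV: "y \<in> pverts G"
    using y[of 1] pos \<open>card R \<le> n\<close> by (auto simp: B_def path_ball_def)
  have "path_dist G y (snd p) \<le> t * l1 x (fst p)" if "p \<in> R" for p
  proof -
    have "p \<in> h ` {0..<card R}" using that by (simp add: bij_betw_imp_surj_on[OF h])
    then obtain i where i: "i < card R" "p = h i" by auto
    then have "e (Suc i) = p" by (simp add: e_def)
    then show ?thesis
      using y[of "Suc i"] i \<open>card R \<le> n\<close> path_dist_sym[OF yV eV[of "Suc i"]]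
      by (auto simp: B_def path_ball_def mult.commute)
  qed
  then show ?thesis using yV by (auto simp: admissible_def)
qed

lemma admissible_if_finite:
  fixes R :: "((int ^ 'd) \<times> 'a) set"
  assumes helly: "helly_multiples (2 * CARD('d)) t G" and "pverts G \<noteq> {}"
    and "finite R" "lipschitz_rel t G R"
  shows "\<exists>y. admissible t G R x y"
  using assms(3,4)
proof (induction "card R" arbitrary: R x rule: less_induct)
  case less
  note fin = \<open>finite R\<close> and R = \<open>lipschitz_rel t G R\<close>
  show ?case
  proof (cases "card R \<le> 2 * CARD('d)")
    case True
    with admissible_if_card_le[OF helly] less.prems assms(2) show ?thesis by blast
  next
    case False
    then obtain a where a: "a \<in> R"
      "\<And>e. \<exists>q\<in>R. q \<noteq> a \<and> coord e (fst a) \<le> coord e (fst q)"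
      using exists_nonextremal_point[OF fin] by (metis not_le)
    \<comment> \<open>Inner induction along the walk from \<open>a\<close>, with \<open>R\<close>
      fixed: the outer hypothesis handles smaller relations at any point.\<close>
    show ?thesis
    proof (induction "l1 x (fst a)" arbitrary: x)
      case 0
      then have "x = fst a" by (simp add: l1_eq_0_iff)
      then have "admissible t G R x (snd a)"
        using R a(1) by (auto simp: lipschitz_rel_def admissible_def)
      then show ?case ..
    next
      case (Suc n)
      then have "x \<noteq> fst a" by auto
      then obtain e where e: "coord e x < coord e (fst a)" by (rule coord_less_if_neq)
      define z where "z = x + dir e 1"
      obtain w where w: "admissible t G R z w"
        using Suc l1_step_towards[OF e] unfolding z_def by force
      \<comment> \<open>\<open>S\<close> keeps the constraints not beyond \<open>x\<close> in
        direction \<open>e\<close>. It misses both \<open>a\<close> and \<open>q\<close>, so adding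
        \<open>(z, w)\<close> still leaves fewer than \<open>card R\<close> elements.\<close>
      define S where "S = {q \<in> R. coord e (fst q) \<le> coord e x}"
      have S: "S \<subseteq> R" by (auto simp: S_def)
      obtain q where q: "q \<in> R" "q \<noteq> a" "coord e (fst a) \<le> coord e (fst q)"
        using a(2) by blast
      have "S \<subseteq> R - {a, q}" using e q by (auto simp: S_def)
      then have "card S \<le> card R - 2"
        using card_mono[of "R - {a, q}" S] fin a(1) q(1,2) by (simp add: card_Diff_subset)
      \<comment> \<open>This rules out truncation in \<open>card R - 2\<close>.\<close>
      moreover have "card {a, q} \<le> card R"
        using fin a(1) q(1) by (intro card_mono) auto
      moreover have "finite S" using S fin by (rule finite_subset)
      ultimately have smaller: "card (insert (z, w) S) < card R"
        using q(2) by (auto simp: card_insert_if)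
      \<comment> \<open>\<open>w\<close> respects all of \<open>R\<close>, not only
        \<open>S\<close>; the dropped constraints are recovered through it below.\<close>
      have Rz: "lipschitz_rel t G (insert (z, w) R)" by (rule lipschitz_rel_insert[OF R w])
      then have "lipschitz_rel t G (insert (z, w) S)"
        by (rule lipschitz_rel_subset) (use S in auto)
      with less.hyps[OF smaller] \<open>finite S\<close>
      obtain y where y: "admissible t G (insert (z, w) S) x y" by blast
      have "path_dist G y (snd p) \<le> t * l1 x (fst p)" if "p \<in> R" for p
      proof (cases "p \<in> S")
        case True
        then show ?thesis using y by (auto simp: admissible_def)
      next
        case False
        then have p: "coord e x < coord e (fst p)" using that by (auto simp: S_def)
        have "l1 z x = 1"
          unfolding z_def by (subst l1_step_away) simp_all
        \<comment> \<open>\<open>p\<close> is beyond \<open>x\<close> in direction \<open>e\<close>,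
          so the step to \<open>z\<close> begins a geodesic from \<open>x\<close> to
          \<open>p\<close>.\<close>
        show ?thesis
        proof (rule admissible_transfer[OF y, where c = "(z, w)"])
          show "lipschitz_rel t G (insert p (insert (z, w) S))"
            using Rz by (rule lipschitz_rel_subset) (use S that in auto)
          show "l1 x (fst p) = l1 x (fst (z, w)) + l1 (fst (z, w)) (fst p)"
            using l1_step_towards[OF p] \<open>l1 z x = 1\<close> by (simp add: z_def l1_sym[of x])
        qed simp
      qed
      then have "admissible t G R x y" using y by (simp add: admissible_def)
      then show ?case ..
    qed
  qed
qed

lemma admissible_exists:
  fixes R :: "((int ^ 'd) \<times> 'a) set"
  assumes helly: "helly_multiples (2 * CARD('d)) t G" and "pverts G \<noteq> {}"
    and R: "lipschitz_rel t G R"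
  shows "\<exists>y. admissible t G R x y"
proof -
  \<comment> \<open>The measures are the positive parts of the displacement from \<open>x\<close> in
    each signed direction, as in the premise of \<open>l1_between\<close>.\<close>
  obtain F where F: "F \<subseteq> R" "finite F"
    "\<And>a. a \<in> R \<Longrightarrow> \<exists>c\<in>F. \<forall>e. nat (coord e (fst c) - coord e x) \<le> nat (coord e (fst a) - coord e x)"
    using dickson[of UNIV R "\<lambda>e p. nat (coord e (fst p) - coord e x)"] by auto
  obtain y where y: "admissible t G F x y"
    using admissible_if_finite[OF helly assms(2) F(2) lipschitz_rel_subset[OF R F(1)]] by blast
  have "path_dist G y (snd a) \<le> t * l1 x (fst a)" if a: "a \<in> R" for a
  proof -
    obtain c where c: "c \<in> F"
      "\<And>e. nat (coord e (fst c) - coord e x) \<le> nat (coord e (fst a) - coord e x)"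
      using F(3)[OF a] by blast
    show ?thesis
    proof (rule admissible_transfer[OF y _ c(1)])
      show "lipschitz_rel t G (insert a F)"
        using R by (rule lipschitz_rel_subset) (use F(1) a in auto)
      show "l1 x (fst a) = l1 x (fst c) + l1 (fst c) (fst a)"
        using l1_between[of "fst c" x "fst a", OF c(2)]
        by (simp add: l1_sym[of x] l1_sym[of "fst c" "fst a"])
    qed
  qed
  then show ?thesis using y by (auto simp: admissible_def)
qed

text \<open>The Lipschitz condition involves two pairs at a time, so it passes to unions of chains.
  A maximal relation is total, since an admissible pair can be inserted at any
  \<open>x\<close>.\<close>

lemma lipschitz_rel_total_extension:
  fixes R :: "((int ^ 'd) \<times> 'a) set"
  assumes "helly_multiples (2 * CARD('d)) t G" "pverts G \<noteq> {}" "lipschitz_rel t G R"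
  obtains M where "R \<subseteq> M" "lipschitz_rel t G M" "fst ` M = UNIV"
proof -
  let ?C = "{M. R \<subseteq> M \<and> lipschitz_rel t G M}"
  have "\<exists>M\<in>?C. \<forall>X\<in>?C. M \<subseteq> X \<longrightarrow> X = M"
  proof (rule subset_Zorn_nonempty)
    show "?C \<noteq> {}" using assms(3) by auto
  next
    fix \<C> assume ne: "\<C> \<noteq> {}" and ch: "subset.chain ?C \<C>"
    have sub: "\<C> \<subseteq> ?C" using ch by (auto simp: subset_chain_def)
    have "lipschitz_rel t G (\<Union>\<C>)"
      unfolding lipschitz_rel_def
    proof (intro conjI ballI)
      show "snd ` \<Union>\<C> \<subseteq> pverts G" using sub unfolding lipschitz_rel_def by blast
      fix p q assume "p \<in> \<Union>\<C>" "q \<in> \<Union>\<C>"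
      then obtain X Y where "X \<in> \<C>" "p \<in> X" "Y \<in> \<C>" "q \<in> Y" by blast
      moreover from this have "X \<subseteq> Y \<or> Y \<subseteq> X" using ch by (auto simp: subset_chain_def)
      ultimately obtain Z where "Z \<in> \<C>" "p \<in> Z" "q \<in> Z" by blast
      then show "path_dist G (snd p) (snd q) \<le> t * l1 (fst p) (fst q)"
        using sub unfolding lipschitz_rel_def by blast
    qed
    then show "\<Union>\<C> \<in> ?C" using ne sub by blast
  qed
  then obtain M where "M \<in> ?C" and max: "\<forall>X\<in>?C. M \<subseteq> X \<longrightarrow> X = M" ..
  then have M: "R \<subseteq> M" "lipschitz_rel t G M" by simp_all
  have "x \<in> fst ` M" for x
  proof -
    obtain y where "admissible t G M x y" using admissible_exists[OF assms(1,2) M(2)] by blast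
    then have "lipschitz_rel t G (insert (x, y) M)" by (rule lipschitz_rel_insert[OF M(2)])
    then have "insert (x, y) M = M" using M(1) max by blast
    then show ?thesis by force
  qed
  then show thesis using that[OF M] by auto
qed

lemma lipschitz_map_extension:
  fixes A :: "(int ^ 'd) set"
  assumes "helly_multiples (2 * CARD('d)) t G" "pverts G \<noteq> {}"
    and f: "lipschitz_map t int_lattice A G f"
  shows "\<exists>g. lipschitz_map t int_lattice UNIV G g \<and> (\<forall>a\<in>A. g a = f a)"
proof -
  have "lipschitz_rel t G ((\<lambda>a. (a, f a)) ` A)"
    using f by (auto simp: lipschitz_map_def lipschitz_rel_def path_dist_int_lattice)
  then obtain M where M: "(\<lambda>a. (a, f a)) ` A \<subseteq> M" "lipschitz_rel t G M" "fst ` M = UNIV"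
    using lipschitz_rel_total_extension[OF assms(1,2)] by metis
  have "\<forall>x. \<exists>y. (x, y) \<in> M"
    using M(3) by (metis UNIV_I imageE prod.collapse)
  then obtain g where g: "\<And>x. (x, g x) \<in> M" by metis
  have "g a = f a" if "a \<in> A" for a
    using lipschitz_rel_single_valued[OF M(2) g, of a "f a"] M(1) that by blast
  moreover have "lipschitz_map t int_lattice UNIV G g"
    unfolding lipschitz_map_def path_dist_int_lattice
  proof (intro conjI ballI subsetI)
    show "path_dist G (g x) (g y) \<le> t * l1 x y" for x y
      using M(2) g[of x] g[of y] by (force simp: lipschitz_rel_def)
    show "y \<in> pverts G" if "y \<in> range g" for y
      using M(2) g that by (force simp: lipschitz_rel_def)
  qed
  ultimately show ?thesis by blast
qed

section \<open>From extensions back to the Helly property\<close>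

text \<open>
  The centre of the \<open>m\<close>-th ball, of radius \<open>k t\<close>, is prescribed as the value at distance \<open>k\<close> from
  the origin along the \<open>m\<close>-th signed axis; the value of an extension at the origin is a common point.
\<close>

lemma helly_multiples_if_extension:
  assumes ext: "\<And>(A :: (int ^ 'd) set) f. lipschitz_map t int_lattice A G f \<Longrightarrow>
      \<exists>g. lipschitz_map t int_lattice UNIV G g \<and> (\<forall>a\<in>A. g a = f a)"
  shows "helly_multiples (2 * CARD('d)) t G"
  unfolding helly_multiples_def
proof (intro allI impI)
  let ?I = "{1..2 * CARD('d)}"
  fix B :: "nat \<Rightarrow> 'a set"
  assume "\<forall>i\<in>?I. \<exists>v\<in>pverts G. \<exists>k. B i = path_ball G v (k * t)"
    and meet: "\<forall>i\<in>?I. \<forall>j\<in>?I. B i \<inter> B j \<noteq> {}"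
  then obtain v k where v: "\<And>i. i \<in> ?I \<Longrightarrow> v i \<in> pverts G"
    and B: "\<And>i. i \<in> ?I \<Longrightarrow> B i = path_ball G (v i) (k i * t)"
    by metis
  have "card ?I = CARD('d \<times> bool)" by simp
  then obtain h :: "nat \<Rightarrow> 'd \<times> bool" where h: "bij_betw h ?I UNIV"
    using finite_same_card_bij[of ?I "UNIV :: ('d \<times> bool) set"] by auto
  define p where "p i = dir (h i) (int (k i))" for i
  have dist: "path_dist G (v i) (v j) \<le> t * l1 (p i) (p j)" if "i \<in> ?I" "j \<in> ?I" for i j
  proof (cases "i = j")
    case True
    then show ?thesis using v that by simp
  next
    case False
    then have "h i \<noteq> h j"
      by (simp add: inj_on_eq_iff[OF bij_betw_imp_inj_on[OF h] that])
    then have "l1 (p i) (p j) = k i + k j" by (simp add: p_def l1_dir_dir)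
    moreover have "B i \<inter> B j \<noteq> {}" by (rule meet[rule_format, OF that])
    then obtain w where "w \<in> B i" "w \<in> B j" by blast
    then have w: "w \<in> pverts G" "path_dist G (v i) w \<le> k i * t" "path_dist G (v j) w \<le> k j * t"
      using B that by (auto simp: path_ball_def)
    moreover have "path_dist G (v i) (v j) \<le> path_dist G (v i) w + path_dist G (v j) w"
      using path_dist_triangle[of "v i" w "v j"] path_dist_sym[of w "v j"] v that w(1) by simp
    ultimately show ?thesis by (simp add: algebra_simps)
  qed
  \<comment> \<open>Distinct indices share a point \<open>p i\<close> only at the origin, for radius
    0. The choice is harmless: by \<open>dist\<close>, their centres are at distance 0 and hence
    equal.\<close>
  define f where "f a = v (SOME i. i \<in> ?I \<and> p i = a)" for a
  have f: "f (p i) = v i" if "i \<in> ?I" for i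
  proof -
    let ?j = "SOME j. j \<in> ?I \<and> p j = p i"
    have j: "?j \<in> ?I \<and> p ?j = p i" by (rule someI[of _ i]) (use that in simp)
    then have "path_dist G (v ?j) (v i) = 0" using dist[of ?j i] that by simp
    then show ?thesis unfolding f_def using j v that path_dist_eq_0D by blast
  qed
  have "lipschitz_map t int_lattice (p ` ?I) G f"
    using v dist by (auto simp: lipschitz_map_def path_dist_int_lattice f)
  then obtain g where g: "lipschitz_map t int_lattice UNIV G g" "\<And>i. i \<in> ?I \<Longrightarrow> g (p i) = v i"
    using ext f by (metis imageI)
  have "g 0 \<in> B i" if "i \<in> ?I" for i
  proof -
    have "path_dist G (g (p i)) (g 0) \<le> t * l1 (p i) 0" "g 0 \<in> pverts G"
      using g(1) by (auto simp: lipschitz_map_def path_dist_int_lattice)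
    moreover have "l1 (p i) 0 = k i" by (simp add: p_def l1_sym[of _ 0] l1_zero_dir)
    ultimately show ?thesis using g(2) that B by (simp add: path_ball_def mult.commute)
  qed
  then show "(\<Inter>i\<in>?I. B i) \<noteq> {}" by blast
qed

end

theorem theorem4p3:
  fixes H :: "'a pair_pre_digraph" and t :: nat
  assumes "t \<ge> 1"
    and "pair_bidirected_digraph H"
    and "pverts H \<noteq> {}"
    and "Digraph_Component.connected (with_proj H)"
  shows
    "(\<forall>(A :: (int ^ 'd) set) f. lipschitz_map t int_lattice A H f \<longrightarrow>
        (\<exists>g. lipschitz_map t int_lattice UNIV H g \<and> (\<forall>a\<in>A. g a = f a)))
     \<longleftrightarrow>
     (\<forall>B :: nat \<Rightarrow> 'a set.
        (\<forall>i\<in>{1..2 * CARD('d)}. \<exists>v\<in>pverts H. \<exists>k. B i = path_ball H v (k * t)) \<longrightarrow>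
        (\<forall>i\<in>{1..2 * CARD('d)}. \<forall>j\<in>{1..2 * CARD('d)}. B i \<inter> B j \<noteq> {}) \<longrightarrow>
        (\<Inter>i\<in>{1..2 * CARD('d)}. B i) \<noteq> {})"
proof -
  interpret pair_bidirected_digraph H by fact
  \<comment> \<open>Connectedness refers to the symmetrized graph; symmetry of the arcs turns it
    into directed reachability.\<close>
  have "strongly_connected (with_proj H)"
    using pair_sym_arcs assms(4) by (rule symmetric_connected_imp_strongly_connected)
  then interpret connected_sym_digraph H
    by unfold_locales (auto simp: strongly_connected_def)
  show ?thesis
    unfolding helly_multiples_def[symmetric]
    using lipschitz_map_extension[OF _ assms(3)] helly_multiples_if_extension by blast
qed

end
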